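(* Let $G$ be a finite simple graph with independence number $\alpha(G)=2$. Suppose $V(G)$ admits a partition $\{D_1,D_2,D_3\}$ into cliques of $G$ such that (i) $D_1$ is a maximum clique of $G$, and (ii) the induced subgraph $G[D_2\cup D_3]$ has no induced cycle of length $4$. Then $G$ contains an immersion of a complete graph whose set of branch vertices is precisely $D_2\cup D_3$.
   Context: An immersion of a graph $H$ in a graph $G$ is a minimal subgraph $I$ of $G$ for which there is an injection $\mathrm{i}\colon V(H)\to V(I)$ and a set of pairwise edge-disjoint paths $\{P_e : e\in E(H)\}$ in $I$ such that the end vertices of $P_{uv}$ are precisely $\mathrm{i}(u)$ and $\mathrm{i}(v)$. The vertices in the image of $\mathrm{i}$ are the branch vertices. *)

theory Defs
  imports "HOL-Library.Ramsey" "HOL-Library.Disjoint_Sets"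
begin

record 'a sgraph =
  verts :: "'a set"
  edges :: "'a set set"

definition simple_graph :: "'a sgraph \<Rightarrow> bool" where
  "simple_graph G \<longleftrightarrow> edges G \<subseteq> [verts G]\<^bsup>2\<^esup>"

definition finite_simple_graph :: "'a sgraph \<Rightarrow> bool" where
  "finite_simple_graph G \<longleftrightarrow> finite (verts G) \<and> simple_graph G"

definition complete_graph :: "nat \<Rightarrow> nat sgraph" where
  "complete_graph n = \<lparr> verts = {..<n}, edges = [{..<n}]\<^bsup>2\<^esup> \<rparr>"

definition subgraph :: "'a sgraph \<Rightarrow> 'a sgraph \<Rightarrow> bool" where
  "subgraph H G \<longleftrightarrow> simple_graph H \<and> verts H \<subseteq> verts G \<and> edges H \<subseteq> edges G"

definition induced_subgraph :: "'a sgraph \<Rightarrow> 'a set \<Rightarrow> 'a sgraph" where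
  "induced_subgraph G U = \<lparr> verts = U, edges = {e \<in> edges G. e \<subseteq> U} \<rparr>"

definition clique_of :: "'a sgraph \<Rightarrow> 'a set \<Rightarrow> bool" where
  "clique_of G D \<longleftrightarrow> D \<subseteq> verts G \<and> clique D (edges G)"

definition maximum_clique :: "'a sgraph \<Rightarrow> 'a set \<Rightarrow> bool" where
  "maximum_clique G D \<longleftrightarrow> clique_of G D \<and> (\<forall>C. clique_of G C \<longrightarrow> card C \<le> card D)"

definition independence_number :: "'a sgraph \<Rightarrow> nat" where
  "independence_number G = Max {card S | S. S \<subseteq> verts G \<and> indep S (edges G)}"

text \<open>Paths and cycles are given by the lists of their vertices in order.\<close>

fun path_edges :: "'a list \<Rightarrow> 'a set set" where
  "path_edges (x # y # p) = insert {x, y} (path_edges (y # p))"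
| "path_edges _ = {}"

definition path_in :: "'a sgraph \<Rightarrow> 'a list \<Rightarrow> bool" where
  "path_in G p \<longleftrightarrow> p \<noteq> [] \<and> distinct p \<and> set p \<subseteq> verts G \<and> path_edges p \<subseteq> edges G"

definition cycle_edges :: "'a list \<Rightarrow> 'a set set" where
  "cycle_edges c = insert {last c, hd c} (path_edges c)"

definition cycle_in :: "'a sgraph \<Rightarrow> 'a list \<Rightarrow> bool" where
  "cycle_in G c \<longleftrightarrow>
     3 \<le> length c \<and> distinct c \<and> set c \<subseteq> verts G \<and> cycle_edges c \<subseteq> edges G"

definition induced_cycle_in :: "'a sgraph \<Rightarrow> 'a list \<Rightarrow> bool" where
  "induced_cycle_in G c \<longleftrightarrow> cycle_in G c \<and> edges (induced_subgraph G (set c)) = cycle_edges c"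

definition immersion_system ::
    "'b sgraph \<Rightarrow> 'a sgraph \<Rightarrow> ('b \<Rightarrow> 'a) \<Rightarrow> ('b set \<Rightarrow> 'a list) \<Rightarrow> bool" where
  "immersion_system H I i P \<longleftrightarrow>
     inj_on i (verts H) \<and> i ` verts H \<subseteq> verts I \<and>
     (\<forall>e \<in> edges H. path_in I (P e) \<and> {hd (P e), last (P e)} = i ` e) \<and>
     disjoint_family_on (\<lambda>e. path_edges (P e)) (edges H)"

text \<open>
  Minimality of \<open>I\<close> is with respect to the given injection \<open>i\<close>: no proper subgraph of \<open>I\<close>
  carries a path system for the same \<open>i\<close>. The set of branch vertices of the immersion is
  \<open>i ` verts H\<close>. If the injection were allowed to change as well, \<open>I\<close> could fail to be minimal
  merely because a proper subgraph is an immersion of \<open>H\<close> on other branch vertices (for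
  example, a union of two triangles sharing a vertex, for \<open>H\<close> a triangle whose branch vertices
  do not all lie in one of the two).
\<close>

definition immersion :: "'b sgraph \<Rightarrow> 'a sgraph \<Rightarrow> ('b \<Rightarrow> 'a) \<Rightarrow> 'a sgraph \<Rightarrow> bool" where
  "immersion H G i I \<longleftrightarrow>
     subgraph I G \<and> (\<exists>P. immersion_system H I i P) \<and>
     (\<forall>J. subgraph J I \<and> (\<exists>P. immersion_system H J i P) \<longrightarrow> J = I)"

end

theory Submission
  imports Defs
begin

text \<open>
  Since \<open>D1\<close> is a maximum clique, Hall's theorem provides injections \<open>f\<close> from \<open>D2\<close> and \<open>g\<close> from
  \<open>D3\<close> into \<open>D1\<close> sending every vertex to a non-neighbour of it. If \<open>a \<in> D2\<close> and \<open>b \<in> D3\<close> are not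
  adjacent, then no vertex avoids both of them, so \<open>a, g b, f a, b\<close> is a path. Two such paths can
  only share the middle edge, with \<open>f a = g b'\<close> and \<open>g b = f a'\<close>; then \<open>a, a', b, b'\<close> is an induced
  cycle of length \<open>4\<close>.
\<close>

section \<open>Hall's theorem\<close>

text \<open>Induction on the index set, in the manner of Halmos and Vaughan. If some non-empty
  proper \<open>J\<close> is tight, meaning that its sets cover exactly \<open>card J\<close>
  elements, then \<open>J\<close> and \<open>I - J\<close> are matched separately. If none is tight,
  every such subset has an element to spare, so one index may take any element of its set.\<close>

lemma hall:
  assumes "finite I"
    and "\<And>i. i \<in> I \<Longrightarrow> finite (A i)"
    and "\<And>J. J \<subseteq> I \<Longrightarrow> card J \<le> card (\<Union> (A ` J))"
  shows "\<exists>f. inj_on f I \<and> (\<forall>i\<in>I. f i \<in> A i)"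
  using assms
proof (induction I arbitrary: A rule: finite_psubset_induct)
  case (psubset I)
  have fin: "finite J" "finite (\<Union> (A ` J))" if "J \<subseteq> I" for J
    using that psubset.hyps psubset.prems(1) finite_subset by (blast, blast)
  show ?case
  proof (cases "\<exists>J. J \<noteq> {} \<and> J \<subset> I \<and> card (\<Union> (A ` J)) = card J")
    case True
    then obtain J where J: "J \<noteq> {}" "J \<subset> I" "card (\<Union> (A ` J)) = card J"
      by blast
    define U where "U = \<Union> (A ` J)"
    have "\<exists>f. inj_on f J \<and> (\<forall>i\<in>J. f i \<in> A i)"
      using J(2) psubset.prems by (intro psubset.IH) auto
    then obtain f where f: "inj_on f J" "\<And>i. i \<in> J \<Longrightarrow> f i \<in> A i"
      by blast
    \<comment> \<open>Removing \<open>U\<close> preserves Hall's condition on \<open>I - J\<close>: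
      apply it to \<open>K \<union> J\<close> and subtract \<open>card U\<close>, which equals
      \<open>card J\<close> by tightness.\<close>
    have "\<exists>g. inj_on g (I - J) \<and> (\<forall>i\<in>I - J. g i \<in> A i - U)"
    proof (rule psubset.IH)
      show "I - J \<subset> I"
        using J by blast
      show "finite (A i - U)" if "i \<in> I - J" for i
        using that psubset.prems(1) by blast
      show "card K \<le> card (\<Union>i\<in>K. A i - U)" if "K \<subseteq> I - J" for K
      proof -
        have sub: "K \<union> J \<subseteq> I" "K \<inter> J = {}"
          using that J(2) by auto
        have "card K + card J = card (K \<union> J)"
          using sub fin(1) by (simp add: card_Un_disjoint)
        also have "\<dots> \<le> card (\<Union> (A ` (K \<union> J)))"
          using sub(1) by (rule psubset.prems(2))
        also have "\<Union> (A ` (K \<union> J)) = (\<Union>i\<in>K. A i - U) \<union> U"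
          unfolding U_def by blast
        also have "card \<dots> \<le> card (\<Union>i\<in>K. A i - U) + card U"
          by (rule card_Un_le)
        finally show ?thesis
          using J(3) by (simp add: U_def)
      qed
    qed
    then obtain g where g: "inj_on g (I - J)" "\<And>i. i \<in> I - J \<Longrightarrow> g i \<in> A i - U"
      by blast
    define h where "h i = (if i \<in> J then f i else g i)" for i
    have h_in: "h i \<in> A i" if "i \<in> I" for i
      using that f(2) g(2) by (simp add: h_def)
    \<comment> \<open>This keeps the two matchings apart: on \<open>J\<close> the values of
      \<open>f\<close> lie in \<open>U\<close>, while \<open>g\<close> avoids
      \<open>U\<close>.\<close>
    have h_U: "h i \<in> U \<longleftrightarrow> i \<in> J" if "i \<in> I" for i
      using that f(2) g(2) by (auto simp: h_def U_def)
    have "inj_on h I"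
    proof (rule inj_onI)
      fix i j
      assume ij: "i \<in> I" "j \<in> I" "h i = h j"
      then have "i \<in> J \<longleftrightarrow> j \<in> J"
        using h_U by metis
      then show "i = j"
        using ij f(1) g(1) by (auto simp: h_def inj_on_def split: if_splits)
    qed
    then show ?thesis
      using h_in by blast
  next
    case False
    then have strict: "card J < card (\<Union> (A ` J))" if "J \<noteq> {}" "J \<subset> I" for J
      using that psubset.prems(2)[of J] by (metis le_neq_implies_less psubset_imp_subset)
    show ?thesis
    proof (cases "I = {}")
      case False
      then obtain i where i: "i \<in> I"
        by blast
      have "A i \<noteq> {}"
        using psubset.prems(2)[of "{i}"] i by auto
      then obtain x where x: "x \<in> A i"
        by blast
      \<comment> \<open>Deleting \<open>x\<close> costs a union at most one element, and the strict
        inequality makes up for it.\<close>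
      have "\<exists>g. inj_on g (I - {i}) \<and> (\<forall>j\<in>I - {i}. g j \<in> A j - {x})"
      proof (rule psubset.IH)
        show "I - {i} \<subset> I"
          using i by blast
        show "finite (A j - {x})" if "j \<in> I - {i}" for j
          using that psubset.prems(1) by blast
        show "card K \<le> card (\<Union>j\<in>K. A j - {x})" if "K \<subseteq> I - {i}" for K
        proof (cases "K = {}")
          case False
          have "card K < card (\<Union> (A ` K))"
            using False that i by (intro strict) auto
          moreover have "(\<Union>j\<in>K. A j - {x}) = \<Union> (A ` K) - {x}"
            by blast
          ultimately show ?thesis
            by (auto simp: card_Diff_singleton_if)
        qed simp
      qed
      then obtain g where g: "inj_on g (I - {i})" "\<And>j. j \<in> I - {i} \<Longrightarrow> g j \<in> A j - {x}"
        by blast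
      have "inj_on (g(i := x)) I"
      proof (rule inj_onI)
        fix j k
        assume "j \<in> I" "k \<in> I" "(g(i := x)) j = (g(i := x)) k"
        then show "j = k"
          using g by (cases "j = i"; cases "k = i") (auto simp: inj_on_def)
      qed
      moreover have "\<forall>j\<in>I. (g(i := x)) j \<in> A j"
        using g(2) x by auto
      ultimately show ?thesis
        by blast
    qed simp
  qed
qed

section \<open>Cliques, independent sets and induced four-cycles\<close>

lemma finite_clique_of: "finite (verts G) \<Longrightarrow> clique_of G D \<Longrightarrow> finite D"
  unfolding clique_of_def using finite_subset by blast

lemma simple_graph_no_loop: "simple_graph G \<Longrightarrow> {x, y} \<in> edges G \<Longrightarrow> x \<noteq> y"
  unfolding simple_graph_def by (metis doubleton_in_nsets_2 subset_iff)

text \<open>If a subset \<open>J\<close> of \<open>K\<close> violated Hall's condition, exchanging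
  the vertices of \<open>C\<close> that have a non-neighbour in \<open>J\<close> for
  \<open>J\<close> itself would give a clique larger than \<open>C\<close>. The two cliques may
  overlap: a common vertex counts as its own non-neighbour, since there are no loops.\<close>

lemma maximum_clique_nonadjacent_injection:
  assumes "finite_simple_graph G" "maximum_clique G C" "clique_of G K"
  shows "\<exists>f. inj_on f K \<and> (\<forall>x\<in>K. f x \<in> C \<and> {x, f x} \<notin> edges G)"
proof -
  have finG: "finite (verts G)" and C: "clique_of G C"
    and max: "\<And>D. clique_of G D \<Longrightarrow> card D \<le> card C"
    using assms(1,2) by (auto simp: finite_simple_graph_def maximum_clique_def)
  have finC: "finite C" and finK: "finite K"
    using finG C assms(3) finite_clique_of by blast+
  define A where "A x = {c \<in> C. {x, c} \<notin> edges G}" for x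
  have "\<exists>f. inj_on f K \<and> (\<forall>x\<in>K. f x \<in> A x)"
  proof (rule hall)
    show "finite (A x)" for x
      using finC by (simp add: A_def)
    show "card J \<le> card (\<Union> (A ` J))" if "J \<subseteq> K" for J
    proof -
      define N where "N = \<Union> (A ` J)"
      have sub: "N \<subseteq> C"
        by (auto simp: N_def A_def)
      have adj: "{x, c} \<in> edges G" if "x \<in> J" "c \<in> C - N" for x c
        using that by (auto simp: N_def A_def)
      \<comment> \<open>A vertex of both sets would be adjacent to itself by
        \<open>adj\<close>.\<close>
      have disj: "J \<inter> (C - N) = {}"
        using adj simple_graph_no_loop assms(1) by (fastforce simp: finite_simple_graph_def)
      have "clique (J \<union> (C - N)) (edges G)"
        using adj C assms(3) that
        by (intro clique_Un) (auto simp: clique_of_def intro: smaller_clique)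
      then have "clique_of G (J \<union> (C - N))"
        using that C assms(3) by (auto simp: clique_of_def)
      then have "card (J \<union> (C - N)) \<le> card C"
        by (rule max)
      moreover have "card (J \<union> (C - N)) = card J + card (C - N)"
        using disj finC finK that finite_subset by (intro card_Un_disjoint) auto
      moreover have "card (C - N) = card C - card N" "card N \<le> card C"
        using sub finC finite_subset by (auto intro: card_Diff_subset card_mono)
      ultimately show ?thesis
        by (simp add: N_def)
    qed
  qed (fact finK)
  then show ?thesis
    by (auto simp: A_def)
qed

lemma independence_number_ge:
  assumes "finite (verts G)" "S \<subseteq> verts G" "indep S (edges G)"
  shows "card S \<le> independence_number G"
  unfolding independence_number_def
proof (rule Max_ge)
  have "{card S | S. S \<subseteq> verts G \<and> indep S (edges G)} \<subseteq> card ` Pow (verts G)"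
    by blast
  then show "finite {card S | S. S \<subseteq> verts G \<and> indep S (edges G)}"
    using assms(1) finite_subset by blast
qed (use assms in blast)

lemma independence_number_2_adjacent:
  assumes "finite (verts G)" "independence_number G = 2" "{x, y, z} \<subseteq> verts G" "distinct [x, y, z]"
    and "{x, y} \<notin> edges G" "{x, z} \<notin> edges G"
  shows "{y, z} \<in> edges G"
proof (rule ccontr)
  assume "{y, z} \<notin> edges G"
  then have "indep {x, y, z} (edges G)"
    using assms(5,6) by (auto simp: indep_def insert_commute)
  then have "card {x, y, z} \<le> 2"
    using independence_number_ge assms(1-3) by metis
  then show False
    using assms(4) by simp
qed

text \<open>Four vertices span six pairs. The four sides are edges and the two diagonals are not, so
  every edge among these vertices belongs to the cycle.\<close>

lemma induced_cycle_4I: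
  assumes "simple_graph G" "{a, a', b, b'} \<subseteq> U" "distinct [a, a', b, b']"
    and "{a, a'} \<in> edges G" "{a', b} \<in> edges G" "{b, b'} \<in> edges G" "{a, b'} \<in> edges G"
    and "{a, b} \<notin> edges G" "{a', b'} \<notin> edges G"
  shows "induced_cycle_in (induced_subgraph G U) [a, a', b, b']"
proof -
  have "{e \<in> edges G. e \<subseteq> {a, a', b, b'}} \<subseteq> cycle_edges [a, a', b, b']"
  proof
    fix e
    assume e: "e \<in> {e \<in> edges G. e \<subseteq> {a, a', b, b'}}"
    then have "e \<in> [verts G]\<^bsup>2\<^esup>"
      using assms(1) by (auto simp: simple_graph_def)
    then obtain x y where "e = {x, y}" "x \<noteq> y"
      by (rule nsets2_E)
    then show "e \<in> cycle_edges [a, a', b, b']"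
      using e assms(8,9) by (auto simp: cycle_edges_def insert_commute)
  qed
  then show ?thesis
    using assms(2-7)
    by (auto simp: induced_cycle_in_def cycle_in_def induced_subgraph_def cycle_edges_def
        insert_commute)
qed

section \<open>Immersions from edge-disjoint paths\<close>

text \<open>Among the subgraphs carrying a path system for \<open>i\<close>, one with the fewest
  vertices and edges in total is also minimal under inclusion. Since \<open>i\<close> stays fixed,
  so do the branch vertices.\<close>

lemma immersion_system_imp_immersion:
  assumes "finite_simple_graph G" "immersion_system H G i P"
  shows "\<exists>I. immersion H G i I"
proof -
  define good where "good J \<longleftrightarrow> subgraph J G \<and> (\<exists>P. immersion_system H J i P)" for J
  have "good G"
    using assms by (auto simp: good_def subgraph_def finite_simple_graph_def)
  then obtain I where I: "good I"
    and least: "\<And>J. good J \<Longrightarrow> card (verts I) + card (edges I) \<le> card (verts J) + card (edges J)"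
    using ex_has_least_nat[of good G "\<lambda>J. card (verts J) + card (edges J)"] by blast
  have "finite (edges G)"
    using assms(1) finite_imp_finite_nsets finite_subset
    by (auto simp: finite_simple_graph_def simple_graph_def)
  then have fin: "finite (verts I)" "finite (edges I)"
    using I assms(1) finite_subset by (auto simp: good_def subgraph_def finite_simple_graph_def)
  have "J = I" if J: "subgraph J I" "\<exists>P. immersion_system H J i P" for J
  proof -
    have sub: "verts J \<subseteq> verts I" "edges J \<subseteq> edges I"
      using J(1) by (auto simp: subgraph_def)
    have "good J"
      using J I by (auto simp: good_def subgraph_def)
    then have "card (verts I) + card (edges I) \<le> card (verts J) + card (edges J)"
      by (rule least)
    moreover have "card (verts J) \<le> card (verts I)" "card (edges J) \<le> card (edges I)"
      using sub fin by (auto intro: card_mono)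
    ultimately have "card (verts J) = card (verts I)" "card (edges J) = card (edges I)"
      by linarith+
    then have "verts J = verts I" "edges J = edges I"
      using sub fin card_subset_eq by blast+
    then show ?thesis
      by simp
  qed
  then have "immersion H G i I"
    using I by (auto simp: immersion_def good_def)
  then show ?thesis
    by blast
qed

text \<open>A numbering of \<open>U\<close> transports the paths \<open>Q\<close>, indexed by pairs
  in \<open>U\<close>, to the edges of the complete graph. The routing argument can thus speak of
  pairs of vertices of \<open>G\<close> alone.\<close>

lemma complete_immersionI:
  assumes "finite_simple_graph G" "U \<subseteq> verts G"
    and "\<And>e. e \<in> [U]\<^bsup>2\<^esup> \<Longrightarrow> path_in G (Q e) \<and> {hd (Q e), last (Q e)} = e"
    and "disjoint_family_on (\<lambda>e. path_edges (Q e)) ([U]\<^bsup>2\<^esup>)"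
  shows "\<exists>n i I. immersion (complete_graph n) G i I \<and> i ` verts (complete_graph n) = U"
proof -
  have "finite U"
    using assms(1,2) finite_subset by (auto simp: finite_simple_graph_def)
  then obtain i where i: "bij_betw i {..<card U} U"
    using ex_bij_betw_nat_finite by (metis atLeast0LessThan)
  have bij: "bij_betw ((`) i) ([{..<card U}]\<^bsup>2\<^esup>) ([U]\<^bsup>2\<^esup>)"
    using bij_betw_nsets[OF i] .
  have "immersion_system (complete_graph (card U)) G i (\<lambda>e. Q (i ` e))"
    unfolding immersion_system_def complete_graph_def
  proof (simp, intro conjI ballI)
    show "inj_on i {..<card U}" "i ` {..<card U} \<subseteq> verts G"
      using i assms(2) by (auto simp: bij_betw_def)
    show "path_in G (Q (i ` e))" "{hd (Q (i ` e)), last (Q (i ` e))} = i ` e"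
      if "e \<in> [{..<card U}]\<^bsup>2\<^esup>" for e
      using assms(3) bij that by (auto simp: bij_betw_def)
    show "disjoint_family_on (\<lambda>e. path_edges (Q (i ` e))) ([{..<card U}]\<^bsup>2\<^esup>)"
      unfolding disjoint_family_on_def
    proof (intro ballI impI)
      fix e e'
      assume "e \<in> [{..<card U}]\<^bsup>2\<^esup>" "e' \<in> [{..<card U}]\<^bsup>2\<^esup>" "e \<noteq> e'"
      then have "i ` e \<in> [U]\<^bsup>2\<^esup>" "i ` e' \<in> [U]\<^bsup>2\<^esup>" "i ` e \<noteq> i ` e'"
        using bij bij_betwE[OF bij] by (auto dest: bij_betw_imp_inj_on inj_onD)
      then show "path_edges (Q (i ` e)) \<inter> path_edges (Q (i ` e')) = {}"
        by (rule disjoint_family_onD[OF assms(4)])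
    qed
  qed
  then obtain I where "immersion (complete_graph (card U)) G i I"
    using immersion_system_imp_immersion assms(1) by blast
  moreover have "i ` verts (complete_graph (card U)) = U"
    using i by (simp add: bij_betw_def complete_graph_def)
  ultimately show ?thesis
    by blast
qed

section \<open>Routing through the maximum clique\<close>

theorem theorem13:
  fixes G :: "'a sgraph" and D1 D2 D3 :: "'a set"
  assumes "finite_simple_graph G"
    and "independence_number G = 2"
    and "partition_on (verts G) {D1, D2, D3}"
    and "distinct [D1, D2, D3]"
    and "clique_of G D1" and "clique_of G D2" and "clique_of G D3"
    and "maximum_clique G D1"
    and "\<not> (\<exists>c. induced_cycle_in (induced_subgraph G (D2 \<union> D3)) c \<and> length c = 4)"
  shows "\<exists>(n :: nat) (i :: nat \<Rightarrow> 'a) (I :: 'a sgraph).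
    immersion (complete_graph n) G i I \<and> i ` verts (complete_graph n) = D2 \<union> D3"
proof -
  let ?E = "edges G"
  have finG: "finite (verts G)" and simp_G: "simple_graph G"
    using assms(1) by (auto simp: finite_simple_graph_def)
  have V: "verts G = D1 \<union> D2 \<union> D3"
    and disj: "D1 \<inter> D2 = {}" "D1 \<inter> D3 = {}" "D2 \<inter> D3 = {}"
    using assms(3,4) by (auto simp: partition_on_def disjoint_def)
  have clique: "{x, y} \<in> ?E" if "x \<noteq> y" "x \<in> D \<and> y \<in> D" "D \<in> {D1, D2, D3}" for x y D
    using that assms(5-7) by (auto simp: clique_of_def clique_def)
  obtain f where f: "inj_on f D2" "\<And>a. a \<in> D2 \<Longrightarrow> f a \<in> D1 \<and> {a, f a} \<notin> ?E"
    using maximum_clique_nonadjacent_injection[OF assms(1,8,6)] by blast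
  obtain g where g: "inj_on g D3" "\<And>b. b \<in> D3 \<Longrightarrow> g b \<in> D1 \<and> {b, g b} \<notin> ?E"
    using maximum_clique_nonadjacent_injection[OF assms(1,8,7)] by blast
  have alpha: "{y, z} \<in> ?E"
    if "x \<in> verts G" "y \<in> verts G" "z \<in> verts G" "distinct [x, y, z]" "{x, y} \<notin> ?E" "{x, z} \<notin> ?E"
    for x y z
    using independence_number_2_adjacent[OF finG assms(2)] that by blast
  have D2_D3: "a \<noteq> b \<and> a \<noteq> f a \<and> a \<noteq> g b \<and> b \<noteq> f a \<and> b \<noteq> g b \<and> {a, b, f a, g b} \<subseteq> verts G"
    if "a \<in> D2" "b \<in> D3" for a b
    using that f(2)[of a] g(2)[of b] disj V by auto
  have route: "{a, g b} \<in> ?E" "{f a, b} \<in> ?E" "f a \<noteq> g b" "{g b, f a} \<in> ?E"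
    if ab: "a \<in> D2" "b \<in> D3" "{a, b} \<notin> ?E" for a b
  proof -
    \<comment> \<open>The vertex \<open>b\<close> is non-adjacent to both \<open>a\<close> and
      \<open>g b\<close>, so independence number 2 makes these two adjacent. The next edge arises in
      the same way from \<open>a\<close>.\<close>
    show 1: "{a, g b} \<in> ?E"
      using alpha[of b a "g b"] D2_D3[OF ab(1,2)] g(2) ab by (auto simp: insert_commute)
    show "{f a, b} \<in> ?E"
      using alpha[of a "f a" b] D2_D3[OF ab(1,2)] f(2) ab by auto
    \<comment> \<open>\<open>a\<close> is adjacent to \<open>g b\<close> but not to
      \<open>f a\<close>.\<close>
    show "f a \<noteq> g b"
      using 1 f(2) ab by metis
    then show "{g b, f a} \<in> ?E"
      using f(2) g(2) ab by (intro clique[of _ _ D1]) auto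
  qed
  have middle: "a = a' \<and> b = b'"
    if ab: "a \<in> D2" "b \<in> D3" "{a, b} \<notin> ?E" and ab': "a' \<in> D2" "b' \<in> D3" "{a', b'} \<notin> ?E"
      and eq: "{g b, f a} = {g b', f a'}" for a b a' b'
  proof -
    have "g b = g b' \<and> f a = f a' \<or> g b = f a' \<and> f a = g b'"
      using eq by (auto simp: doubleton_eq_iff)
    then show ?thesis
    proof
      assume "g b = g b' \<and> f a = f a'"
      then show ?thesis
        using f(1) g(1) ab ab' by (auto simp: inj_on_def)
    next
      \<comment> \<open>Now \<open>f a = g b'\<close> is non-adjacent to both \<open>a\<close> and
        \<open>b'\<close>, and \<open>g b = f a'\<close> to both \<open>a'\<close> and
        \<open>b\<close>, which forces the edges \<open>{a, b'}\<close> and \<open>{a', b}\<close>.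
        With the clique edges \<open>{a, a'}\<close> and \<open>{b, b'}\<close> they form a
        four-cycle whose diagonals are the two given non-edges.\<close>
      assume cross: "g b = f a' \<and> f a = g b'"
      then have "a \<noteq> a'" "b \<noteq> b'"
        using route(3)[OF ab] by auto
      moreover have "{a, b'} \<in> ?E"
        using alpha[of "f a" a b'] D2_D3[OF ab(1) ab'(2)] f(2)[OF ab(1)] g(2)[OF ab'(2)] cross
        by (auto simp: insert_commute)
      moreover have "{a', b} \<in> ?E"
        using alpha[of "g b" a' b] D2_D3[OF ab'(1) ab(2)] f(2)[OF ab'(1)] g(2)[OF ab(2)] cross
        by (auto simp: insert_commute)
      ultimately have "induced_cycle_in (induced_subgraph G (D2 \<union> D3)) [a, a', b, b']"
        using ab ab' disj by (intro induced_cycle_4I[OF simp_G]) (auto intro: clique)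
      moreover have "length [a, a', b, b'] = 4"
        by simp
      ultimately show ?thesis
        using assms(9) by blast
    qed
  qed
  \<comment> \<open>Pairs carry no orientation, so the admissible paths are described by a relation,
    from which \<open>Q\<close> is chosen afterwards. An edge is its own path; a non-edge takes the
    detour through \<open>D1\<close>.\<close>
  define W where "W e p \<longleftrightarrow>
      (if e \<in> ?E then \<exists>u v. e = {u, v} \<and> u \<noteq> v \<and> p = [u, v]
       else \<exists>a\<in>D2. \<exists>b\<in>D3. e = {a, b} \<and> p = [a, g b, f a, b])" for e p
  have "\<exists>p. W e p" if e: "e \<in> [D2 \<union> D3]\<^bsup>2\<^esup>" for e
  proof -
    obtain x y where xy: "e = {x, y}" "x \<in> D2 \<union> D3" "y \<in> D2 \<union> D3" "x \<noteq> y"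
      using e by (rule nsets2_E)
    show ?thesis
    proof (cases "e \<in> ?E")
      case True
      then show ?thesis
        using xy unfolding W_def by auto
    next
      case False
      \<comment> \<open>A non-edge has an end in each part, because \<open>D2\<close> and
        \<open>D3\<close> are cliques.\<close>
      then have "x \<in> D2 \<and> y \<in> D3 \<or> y \<in> D2 \<and> x \<in> D3"
        using xy clique[of x y] by blast
      then show ?thesis
        using False xy(1) unfolding W_def by (auto simp: insert_commute)
    qed
  qed
  then obtain Q where Q: "\<And>e. e \<in> [D2 \<union> D3]\<^bsup>2\<^esup> \<Longrightarrow> W e (Q e)"
    by metis
  show ?thesis
  proof (rule complete_immersionI[OF assms(1)])
    show "D2 \<union> D3 \<subseteq> verts G"
      using V by blast
    show "path_in G (Q e) \<and> {hd (Q e), last (Q e)} = e" if e: "e \<in> [D2 \<union> D3]\<^bsup>2\<^esup>" for e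
    proof (cases "e \<in> ?E")
      case True
      then obtain u v where "e = {u, v}" "u \<noteq> v" "Q e = [u, v]"
        using Q[OF e] by (auto simp: W_def)
      moreover have "e \<subseteq> verts G"
        using e V by (auto simp: nsets_def)
      ultimately show ?thesis
        using True by (auto simp: path_in_def)
    next
      case False
      then obtain a b where "a \<in> D2" "b \<in> D3" "e = {a, b}" "Q e = [a, g b, f a, b]"
        using Q[OF e] by (auto simp: W_def)
      then show ?thesis
        using False route[of a b] D2_D3[of a b] by (auto simp: path_in_def)
    qed
    have edge: "path_edges (Q e) = {e}" if "e \<in> [D2 \<union> D3]\<^bsup>2\<^esup>" "e \<in> ?E" for e
      using Q[OF that(1)] that(2) by (auto simp: W_def)
    have nonedge: "\<exists>a b. a \<in> D2 \<and> b \<in> D3 \<and> {a, b} \<notin> ?E \<and> e = {a, b}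
        \<and> path_edges (Q e) = {{a, g b}, {g b, f a}, {f a, b}}"
      if "e \<in> [D2 \<union> D3]\<^bsup>2\<^esup>" "e \<notin> ?E" for e
      using Q[OF that(1)] that(2) by (fastforce simp: W_def)
    have mixed: "path_edges (Q e) \<inter> path_edges (Q e') = {}"
      if e: "e \<in> [D2 \<union> D3]\<^bsup>2\<^esup>" "e \<in> ?E" and e': "e' \<in> [D2 \<union> D3]\<^bsup>2\<^esup>" "e' \<notin> ?E" for e e'
    proof -
      obtain a b where "a \<in> D2" "b \<in> D3" "path_edges (Q e') = {{a, g b}, {g b, f a}, {f a, b}}"
        using nonedge[OF e'] by blast
      \<comment> \<open>Every edge of a detour has an end in \<open>D1\<close>, where
        \<open>f\<close> and \<open>g\<close> take their values.\<close>
      moreover have "e \<inter> D1 = {}"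
        using e(1) disj by (auto simp: nsets_def)
      ultimately show ?thesis
        using edge[OF e] f(2) g(2) by auto
    qed
    have detours: "e = e'"
      if e: "e \<in> [D2 \<union> D3]\<^bsup>2\<^esup>" "e \<notin> ?E" and e': "e' \<in> [D2 \<union> D3]\<^bsup>2\<^esup>" "e' \<notin> ?E"
        and z: "z \<in> path_edges (Q e)" "z \<in> path_edges (Q e')" for e e' z
    proof -
      obtain a b where ab: "a \<in> D2" "b \<in> D3" "{a, b} \<notin> ?E" "e = {a, b}"
        "path_edges (Q e) = {{a, g b}, {g b, f a}, {f a, b}}"
        using nonedge[OF e] by blast
      obtain a' b' where ab': "a' \<in> D2" "b' \<in> D3" "{a', b'} \<notin> ?E" "e' = {a', b'}"
        "path_edges (Q e') = {{a', g b'}, {g b', f a'}, {f a', b'}}"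
        using nonedge[OF e'] by blast
      have D1: "f a \<in> D1" "f a' \<in> D1" "g b \<in> D1" "g b' \<in> D1"
        using f(2) g(2) ab ab' by auto
      have not_D1: "a \<notin> D1" "a' \<notin> D1" "b \<notin> D1" "b' \<notin> D1"
        using ab(1,2) ab'(1,2) disj by auto
      have neq: "a \<noteq> b'" "b \<noteq> a'"
        using ab(1,2) ab'(1,2) disj by auto
      \<comment> \<open>The edges of a detour run from \<open>D2\<close> to \<open>D1\<close>,
        inside \<open>D1\<close>, and from \<open>D1\<close> to \<open>D3\<close>. These kinds
        exclude one another, so a shared edge has the same position in both detours.\<close>
      have distinct_kinds: "{a, g b} \<noteq> {g b', f a'}" "{a, g b} \<noteq> {f a', b'}" "{g b, f a} \<noteq> {a', g b'}"
        "{g b, f a} \<noteq> {f a', b'}" "{f a, b} \<noteq> {a', g b'}" "{f a, b} \<noteq> {g b', f a'}"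
        using D1 not_D1 neq unfolding doubleton_eq_iff by metis+
      consider "{a, g b} = {a', g b'}" | "{g b, f a} = {g b', f a'}" | "{f a, b} = {f a', b'}"
        using z distinct_kinds unfolding ab(5) ab'(5) by (metis insertE empty_iff)
      then have "a = a' \<and> b = b'"
      proof cases
        case 1
        \<comment> \<open>Only one end of this edge lies in \<open>D1\<close>, so the ends can be
          matched in one way only; injectivity of \<open>g\<close> then recovers
          \<open>b\<close>.\<close>
        then have "a = a'" "g b = g b'"
          using D1 not_D1 unfolding doubleton_eq_iff by metis+
        then show ?thesis
          using g(1) ab(2) ab'(2) by (auto dest: inj_onD)
      next
        case 2
        then show ?thesis
          by (rule middle[OF ab(1-3) ab'(1-3)])
      next
        case 3
        then have "b = b'" "f a = f a'"
          using D1 not_D1 unfolding doubleton_eq_iff by metis+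
        then show ?thesis
          using f(1) ab(1) ab'(1) by (auto dest: inj_onD)
      qed
      then show ?thesis
        using ab(4) ab'(4) by simp
    qed
    show "disjoint_family_on (\<lambda>e. path_edges (Q e)) ([D2 \<union> D3]\<^bsup>2\<^esup>)"
      unfolding disjoint_family_on_def
    proof (intro ballI impI)
      fix e e'
      assume e: "e \<in> [D2 \<union> D3]\<^bsup>2\<^esup>" and e': "e' \<in> [D2 \<union> D3]\<^bsup>2\<^esup>" and "e \<noteq> e'"
      then show "path_edges (Q e) \<inter> path_edges (Q e') = {}"
        using edge mixed[of e e'] mixed[of e' e] detours[of e e']
        by (cases "e \<in> ?E"; cases "e' \<in> ?E") auto
    qed
  qed
qed

end
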